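(* Let $G_1$ and $G_2$ be two graphs of order at least $3$. The following hold, where a graph $X$ is said to satisfy the AVD-TCC if $\chi''_a(X)\le\Delta(X)+3$: (1) If $C(G_1)$ and $C(G_2)$ satisfy the AVD-TCC, then $C(G_1\vee G_2)$ satisfies the AVD-TCC. (2) The graph $C(K_{m,n})$ satisfies the AVD-TCC for any integers $m,n\ge 3$. (3) If $G_1\in\{P_n,C_n,K_n\}$ and $G_2\in\{P_m,C_m,K_m\}$, then $C(G_1\vee G_2)$ satisfies the AVD-TCC for any integers $m,n\ge 3$. (4) If $G_1$ and $G_2$ have the same order, then $C(G_1\vee G_2)$ satisfies the AVD-TCC.
   Context: All graphs are finite, undirected and simple. $\Delta(G)$ is the maximum degree of $G$, and the order of a graph is its number of vertices. $P_n$, $C_n$, $K_n$ denote the path, cycle and complete graph on $n$ vertices, and $K_{m,n}$ the complete bipartite graph with parts of sizes $m$ and $n$. (The notation $C(G)$ for the central graph, defined below, is distinct from $C_n$ and from the color sets $C_G(u)$.) A proper total coloring of $G$ is a coloring of $V(G)\cup E(G)$ in which no two adjacent or incident elements receive the same color. An adjacent vertex distinguishing (AVD) total coloring of $G$ is a proper total coloring $f$ such that $C_G(u)\ne C_G(v)$ for every edge $uv\in E(G)$, where $C_G(u)=\{f(u)\}\cup\{f(uw): uw\in E(G)\}$. The AVD-total chromatic number $\chi''_a(G)$ is the least number of colors in an AVD-total coloring of $G$. The join $G_1\vee G_2$ is obtained from the disjoint union of $G_1$ and $G_2$ by adding all edges between a vertex of $G_1$ and a vertex of $G_2$. The central graph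 $C(G)$ is obtained from $G$ by subdividing each edge exactly once (each edge $xy\in E(G)$ is replaced by the two edges $xw_{xy}$ and $w_{xy}y$, where $w_{xy}$ is a new vertex) and then adding all edges of the complement $\overline{G}$, i.e. joining every pair of distinct vertices of $G$ that are non-adjacent in $G$. *)

theory Defs
  imports Main
begin

record 'a sgraph =
  verts :: "'a set"
  edges :: "'a set set"

definition simple_graph :: "'a sgraph \<Rightarrow> bool" where
  "simple_graph G \<longleftrightarrow> finite (verts G) \<and> (\<forall>e\<in>edges G. e \<subseteq> verts G \<and> card e = 2)"

definition order :: "'a sgraph \<Rightarrow> nat" where
  "order G = card (verts G)"

definition degree :: "'a sgraph \<Rightarrow> 'a \<Rightarrow> nat" where
  "degree G v = card {e \<in> edges G. v \<in> e}"

text \<open>Unspecified for the graph without vertices.\<close>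
definition max_degree :: "'a sgraph \<Rightarrow> nat" where
  "max_degree G = Max (degree G ` verts G)"

definition path_graph :: "nat \<Rightarrow> nat sgraph" where
  "path_graph n = \<lparr>verts = {..<n}, edges = {{i, Suc i} |i. Suc i < n}\<rparr>"

text \<open>Only meaningful for \<open>n \<ge> 3\<close>.\<close>
definition cycle_graph :: "nat \<Rightarrow> nat sgraph" where
  "cycle_graph n = \<lparr>verts = {..<n}, edges = {{i, Suc i mod n} |i. i < n}\<rparr>"

definition complete_graph :: "nat \<Rightarrow> nat sgraph" where
  "complete_graph n = \<lparr>verts = {..<n}, edges = {{i, j} |i j. i < n \<and> j < n \<and> i \<noteq> j}\<rparr>"

definition complete_bipartite_graph :: "nat \<Rightarrow> nat \<Rightarrow> (nat + nat) sgraph" where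
  "complete_bipartite_graph m n =
    \<lparr>verts = Inl ` {..<m} \<union> Inr ` {..<n},
     edges = {{Inl i, Inr j} |i j. i < m \<and> j < n}\<rparr>"

definition join_graph :: "'a sgraph \<Rightarrow> 'b sgraph \<Rightarrow> ('a + 'b) sgraph" where
  "join_graph G H =
    \<lparr>verts = Inl ` verts G \<union> Inr ` verts H,
     edges = image Inl ` edges G \<union> image Inr ` edges H
             \<union> {{Inl x, Inr y} |x y. x \<in> verts G \<and> y \<in> verts H}\<rparr>"

definition complement_graph :: "'a sgraph \<Rightarrow> 'a sgraph" where
  "complement_graph G =
    \<lparr>verts = verts G,
     edges = {{x, y} |x y. x \<in> verts G \<and> y \<in> verts G \<and> x \<noteq> y \<and> {x, y} \<notin> edges G}\<rparr>"

text \<open>A vertex \<open>x\<close> of \<open>G\<close> becomes \<open>Inl x\<close>; the new vertex subdividing an edge \<open>e\<close> is \<open>Inr e\<close>.\<close>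
definition central_graph :: "'a sgraph \<Rightarrow> ('a + 'a set) sgraph" where
  "central_graph G =
    \<lparr>verts = Inl ` verts G \<union> Inr ` edges G,
     edges = {{Inl x, Inr e} |x e. e \<in> edges G \<and> x \<in> e}
             \<union> image Inl ` edges (complement_graph G)\<rparr>"

text \<open>The objects coloured by a total colouring: \<open>Inl v\<close> for a vertex, \<open>Inr e\<close> for an edge.\<close>
definition elements :: "'a sgraph \<Rightarrow> ('a + 'a set) set" where
  "elements G = Inl ` verts G \<union> Inr ` edges G"

fun adjacent_or_incident :: "'a sgraph \<Rightarrow> 'a + 'a set \<Rightarrow> 'a + 'a set \<Rightarrow> bool" where
  "adjacent_or_incident G (Inl u) (Inl v) \<longleftrightarrow> {u, v} \<in> edges G"
| "adjacent_or_incident G (Inl u) (Inr e) \<longleftrightarrow> u \<in> e"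
| "adjacent_or_incident G (Inr e) (Inl u) \<longleftrightarrow> u \<in> e"
| "adjacent_or_incident G (Inr e) (Inr e') \<longleftrightarrow> e \<noteq> e' \<and> e \<inter> e' \<noteq> {}"

definition proper_total_coloring :: "'a sgraph \<Rightarrow> ('a + 'a set \<Rightarrow> nat) \<Rightarrow> bool" where
  "proper_total_coloring G f \<longleftrightarrow>
    (\<forall>s\<in>elements G. \<forall>t\<in>elements G. adjacent_or_incident G s t \<longrightarrow> f s \<noteq> f t)"

definition color_set :: "'a sgraph \<Rightarrow> ('a + 'a set \<Rightarrow> nat) \<Rightarrow> 'a \<Rightarrow> nat set" where
  "color_set G f u = {f (Inl u)} \<union> {f (Inr {u, w}) |w. {u, w} \<in> edges G}"

definition avd_total_coloring :: "'a sgraph \<Rightarrow> ('a + 'a set \<Rightarrow> nat) \<Rightarrow> bool" where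
  "avd_total_coloring G f \<longleftrightarrow> proper_total_coloring G f \<and>
    (\<forall>u v. {u, v} \<in> edges G \<longrightarrow> color_set G f u \<noteq> color_set G f v)"

definition avd_total_chromatic_number :: "'a sgraph \<Rightarrow> nat" where
  "avd_total_chromatic_number G =
    (LEAST k. \<exists>f. avd_total_coloring G f \<and> card (f ` elements G) = k)"

definition satisfies_avd_tcc :: "'a sgraph \<Rightarrow> bool" where
  "satisfies_avd_tcc G \<longleftrightarrow> avd_total_chromatic_number G \<le> max_degree G + 3"

lemma simple_graph_finite_edges:
  assumes "simple_graph G" shows "finite (edges G)"
proof (rule finite_subset)
  show "edges G \<subseteq> Pow (verts G)" "finite (Pow (verts G))"
    using assms by (auto simp: simple_graph_def)
qed

lemma simple_graph_path: "simple_graph (path_graph n)"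
  by (auto simp: simple_graph_def path_graph_def)

lemma simple_graph_cycle: "n \<ge> 3 \<Longrightarrow> simple_graph (cycle_graph n)"
proof -
  assume n: "n \<ge> 3"
  have "i \<noteq> Suc i mod n" if "i < n" for i
    using n that by (cases "Suc i = n") auto
  with n show ?thesis by (auto simp: simple_graph_def cycle_graph_def)
qed

lemma simple_graph_complete: "simple_graph (complete_graph n)"
  by (auto simp: simple_graph_def complete_graph_def)

lemma simple_graph_complete_bipartite: "simple_graph (complete_bipartite_graph m n)"
  by (auto simp: simple_graph_def complete_bipartite_graph_def)

lemma simple_graph_join:
  "simple_graph G \<Longrightarrow> simple_graph H \<Longrightarrow> simple_graph (join_graph G H)"
  by (fastforce simp: simple_graph_def join_graph_def card_image)

lemma simple_graph_complement: "simple_graph G \<Longrightarrow> simple_graph (complement_graph G)"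
  by (auto simp: simple_graph_def complement_graph_def)

lemma simple_graph_central:
  assumes "simple_graph G" shows "simple_graph (central_graph G)"
  using assms simple_graph_finite_edges[OF assms] simple_graph_complement[OF assms]
  by (fastforce simp: simple_graph_def central_graph_def card_image complement_graph_def)

text \<open>The minimum defining the AVD-total chromatic number is over a nonempty set.\<close>
lemma avd_total_coloring_exists:
  assumes "simple_graph G" shows "\<exists>f. avd_total_coloring G f"
proof -
  have "finite (elements G)"
    using assms simple_graph_finite_edges[OF assms] by (simp add: elements_def simple_graph_def)
  then obtain f :: "_ \<Rightarrow> nat" where f: "inj_on f (elements G)"
    using finite_imp_inj_to_nat_seg by blast
  have ne: "u \<noteq> v \<and> u \<in> verts G \<and> v \<in> verts G" if "{u, v} \<in> edges G" for u v
    using assms that by (auto simp: simple_graph_def)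
  have irr: "\<not> adjacent_or_incident G s s" for s
    by (cases s) (use ne[of v v for v] in auto)
  have "color_set G f u \<noteq> color_set G f v" if uv: "{u, v} \<in> edges G" for u v
  proof -
    have "f (Inl u) \<notin> color_set G f v"
      using ne[OF uv] inj_onD[OF f, of "Inl u"] by (auto simp: color_set_def elements_def)
    then show ?thesis by (auto simp: color_set_def)
  qed
  moreover have "proper_total_coloring G f"
    using irr inj_onD[OF f] unfolding proper_total_coloring_def by metis
  ultimately show ?thesis unfolding avd_total_coloring_def by blast
qed

end

theory Submission
  imports Defs
begin

text \<open>In the central graph of a graph of order \<open>N \<ge> 3\<close> every original vertex has degree \<open>N - 1\<close>, so
  \<open>N + 2\<close> colours are allowed. Up to the subdivision vertices, which can be coloured
  greedily at the end, a colouring assigns a colour to every original vertex \<open>x\<close> and a colour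
  \<open>h x y\<close> to the end at \<open>x\<close> of every pair \<open>x, y\<close>, where \<open>h x y\<close> and \<open>h y x\<close> agree for
  non-adjacent pairs and differ for adjacent ones. Such colourings of two graphs of orders \<open>m\<close> and
  \<open>n\<close> are combined by giving the joining ends on the two sides disjoint sets of \<open>n\<close> and \<open>m\<close> colours.
  Edgeless graphs, paths and cycles are coloured by modifications of \<open>i + j\<close> modulo an odd number,
  complete graphs by \<open>h i j = j\<close>. For two graphs of the same order \<open>m\<close>, two copies of a total
  colouring of \<open>K\<^sub>m\<close> with \<open>m + 1\<close> colours are used: switching the copy at one end of each
  edge makes the two ends differ, whatever the graph is.\<close>

section \<open>Half-edge colourings, renaming of colours and missing colours\<close>

definition palette :: "'a set \<Rightarrow> ('a \<Rightarrow> 'c) \<Rightarrow> ('a \<Rightarrow> 'a \<Rightarrow> 'c) \<Rightarrow> 'a \<Rightarrow> 'c set" where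
  "palette V v h x = insert (v x) (h x ` (V - {x}))"

text \<open>Palettes are compared only for non-adjacent pairs, since these are the ones adjacent in
  the central graph. The colours have an arbitrary type because one construction below uses pairs of
  a truth value and a number.\<close>

definition half_edge_coloring ::
    "'a sgraph \<Rightarrow> 'c set \<Rightarrow> ('a \<Rightarrow> 'c) \<Rightarrow> ('a \<Rightarrow> 'a \<Rightarrow> 'c) \<Rightarrow> bool" where
  "half_edge_coloring G C v h \<longleftrightarrow>
    (\<forall>x\<in>verts G. v x \<in> C \<and> inj_on (h x) (verts G - {x}) \<and> h x ` (verts G - {x}) \<subseteq> C - {v x}) \<and>
    (\<forall>x\<in>verts G. \<forall>y\<in>verts G. x \<noteq> y \<longrightarrow>
      (if {x, y} \<in> edges G then h x y \<noteq> h y x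
       else h x y = h y x \<and> v x \<noteq> v y \<and>
            palette (verts G) v h x \<noteq> palette (verts G) v h y))"

lemma half_edge_coloringD:
  assumes "half_edge_coloring G C v h" "x \<in> verts G"
  shows "v x \<in> C" "inj_on (h x) (verts G - {x})"
    "\<And>y. y \<in> verts G \<Longrightarrow> y \<noteq> x \<Longrightarrow> h x y \<in> C \<and> h x y \<noteq> v x"
    "\<And>y. y \<in> verts G \<Longrightarrow> y \<noteq> x \<Longrightarrow> {x, y} \<in> edges G \<Longrightarrow> h x y \<noteq> h y x"
    "\<And>y. y \<in> verts G \<Longrightarrow> y \<noteq> x \<Longrightarrow> {x, y} \<notin> edges G \<Longrightarrow>
      h x y = h y x \<and> v x \<noteq> v y \<and> palette (verts G) v h x \<noteq> palette (verts G) v h y"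
  using assms unfolding half_edge_coloring_def by (blast, blast, blast, metis, metis)

lemma card_palette:
  assumes "finite V" "x \<in> V" "inj_on (h x) (V - {x})" "v x \<notin> h x ` (V - {x})"
  shows "card (palette V v h x) = card V"
  using assms card_gt_0_iff[of V] by (auto simp: palette_def card_image)

text \<open>Palettes are subsets of \<open>C\<close>, where \<open>g\<close> is injective, so
  different palettes have different images. A construction may thus pick convenient colours and only
  count them afterwards.\<close>

lemma half_edge_coloring_recolor:
  assumes h: "half_edge_coloring G C v h" and g: "inj_on g C" and D: "g ` C \<subseteq> D"
  shows "half_edge_coloring G D (\<lambda>x. g (v x)) (\<lambda>x y. g (h x y))"
proof -
  note d = half_edge_coloringD[OF h]
  have pal: "palette (verts G) (\<lambda>x. g (v x)) (\<lambda>x y. g (h x y)) x = g ` palette (verts G) v h x" for x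
    by (auto simp: palette_def)
  have sub: "palette (verts G) v h x \<subseteq> C" if "x \<in> verts G" for x
    using d(1,3)[OF that] by (auto simp: palette_def)
  have "inj_on (\<lambda>y. g (h x y)) (verts G - {x})" if "x \<in> verts G" for x
    using d(2,3)[OF that] g by (auto simp: inj_on_def)
  moreover have "palette (verts G) v h x \<noteq> palette (verts G) v h y \<Longrightarrow>
      g ` palette (verts G) v h x \<noteq> g ` palette (verts G) v h y"
    if "x \<in> verts G" "y \<in> verts G" for x y
    using inj_on_image_eq_iff[OF g sub sub] that by blast
  ultimately show ?thesis
    using d D unfolding half_edge_coloring_def pal
    by (auto simp: inj_on_eq_iff[OF g]) metis
qed

lemma half_edge_coloring_lessThan:
  assumes "half_edge_coloring G C v h" "finite C" "card C \<le> k"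
  shows "\<exists>v' h'. half_edge_coloring G {..<k} v' h'"
proof -
  obtain g where "inj_on g C" "g ` C = {..<card C}"
    by (metis assms(2) bij_betw_def ex_bij_betw_finite_nat lessThan_atLeast0)
  then show ?thesis
    using half_edge_coloring_recolor[OF assms(1), of g "{..<k}"] assms(3) by auto
qed

text \<open>With \<open>order G + 2\<close> colours every vertex misses exactly two, \<open>a x\<close> and \<open>b x\<close>, so palettes are
  compared through their complements.\<close>
lemma half_edge_coloringI_missing:
  assumes fin: "finite (verts G)" "finite C" and card: "card C = card (verts G) + 2"
    and C: "\<And>x. x \<in> verts G \<Longrightarrow> v x \<in> C"
      "\<And>x y. x \<in> verts G \<Longrightarrow> y \<in> verts G \<Longrightarrow> x \<noteq> y \<Longrightarrow> h x y \<in> C \<and> h x y \<noteq> v x"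
    and inj: "\<And>x y z. x \<in> verts G \<Longrightarrow> y \<in> verts G \<Longrightarrow> z \<in> verts G \<Longrightarrow> x \<noteq> y \<Longrightarrow> x \<noteq> z \<Longrightarrow>
      h x y = h x z \<Longrightarrow> y = z"
    and miss: "\<And>x. x \<in> verts G \<Longrightarrow> a x \<in> C \<and> b x \<in> C \<and> a x \<noteq> b x \<and> a x \<noteq> v x \<and> b x \<noteq> v x"
      "\<And>x y. x \<in> verts G \<Longrightarrow> y \<in> verts G \<Longrightarrow> x \<noteq> y \<Longrightarrow> a x \<noteq> h x y \<and> b x \<noteq> h x y"
    and edge: "\<And>x y. x \<in> verts G \<Longrightarrow> y \<in> verts G \<Longrightarrow> x \<noteq> y \<Longrightarrow> {x, y} \<in> edges G \<Longrightarrow> h x y \<noteq> h y x"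
    and nonedge: "\<And>x y. x \<in> verts G \<Longrightarrow> y \<in> verts G \<Longrightarrow> x \<noteq> y \<Longrightarrow> {x, y} \<notin> edges G \<Longrightarrow>
      h x y = h y x \<and> v x \<noteq> v y \<and> {a x, b x} \<noteq> {a y, b y}"
  shows "half_edge_coloring G C v h"
proof -
  have i: "inj_on (h x) (verts G - {x})" if "x \<in> verts G" for x
    using inj[OF that] by (auto simp: inj_on_def)
  have pal: "C - palette (verts G) v h x = {a x, b x}" if x: "x \<in> verts G" for x
  proof -
    have "palette (verts G) v h x \<subseteq> C"
      using C x by (auto simp: palette_def)
    moreover have "card (palette (verts G) v h x) = card (verts G)"
      using C(2)[OF x] by (intro card_palette fin i x) force
    ultimately have "card (C - palette (verts G) v h x) = 2"
      using card fin(2) by (simp add: card_Diff_subset finite_subset)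
    moreover have "{a x, b x} \<subseteq> C - palette (verts G) v h x" "card {a x, b x} = 2"
      using miss x by (auto simp: palette_def)
    ultimately show ?thesis
      using fin(2) by (metis card_subset_eq finite_Diff)
  qed
  show ?thesis
    unfolding half_edge_coloring_def using i C edge nonedge pal by (auto; metis)
qed

subsection \<open>Central graphs\<close>

text \<open>For adjacent \<open>x\<close> and \<open>y\<close> the two orders of the arguments give
  the two halves of the subdivided edge; for non-adjacent ones both orders give the same complement
  edge.\<close>

definition half_edge :: "'a sgraph \<Rightarrow> 'a \<Rightarrow> 'a \<Rightarrow> ('a + 'a set) set" where
  "half_edge G x y = (if {x, y} \<in> edges G then {Inl x, Inr {x, y}} else {Inl x, Inl y})"

lemma edge_obtain:
  assumes "simple_graph G" "e \<in> edges G"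
  obtains x y where "x \<in> verts G" "y \<in> verts G" "x \<noteq> y" "e = {x, y}"
proof -
  have "card e = 2" "e \<subseteq> verts G" using assms by (auto simp: simple_graph_def)
  then show ?thesis using that by (auto simp: card_2_iff)
qed

text \<open>A half of a subdivided edge remembers its ordered pair, a complement edge only the
  unordered one. Hence a colour \<open>h x y\<close> that is symmetric on non-adjacent pairs is a
  function of the edge.\<close>

lemma half_edge_eqD:
  assumes "half_edge G x y = half_edge G x' y'"
  shows "x = x' \<and> y = y' \<or> {x, y} \<notin> edges G \<and> x = y' \<and> y = x'"
  using assms by (auto simp: half_edge_def doubleton_eq_iff split: if_splits)

text \<open>A single parametrization by ordered pairs covers halves and complement edges alike, so
  that later arguments treat both kinds together.\<close>

lemma edges_central:
  assumes "simple_graph G"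
  shows "edges (central_graph G) =
    {half_edge G x y |x y. x \<in> verts G \<and> y \<in> verts G \<and> x \<noteq> y}" (is "?L = ?R")
proof
  show "?L \<subseteq> ?R"
  proof
    fix E assume "E \<in> ?L"
    then consider x e where "E = {Inl x, Inr e}" "e \<in> edges G" "x \<in> e"
      | x y where "E = {Inl x, Inl y}" "x \<in> verts G" "y \<in> verts G" "x \<noteq> y" "{x, y} \<notin> edges G"
      by (auto simp: central_graph_def complement_graph_def)
    then show "E \<in> ?R"
    proof cases
      case 1
      obtain a b where ab: "a \<in> verts G" "b \<in> verts G" "a \<noteq> b" "e = {a, b}"
        using edge_obtain[OF assms 1(2)] .
      then have "E = half_edge G a b \<or> E = half_edge G b a"
        using 1 by (auto simp: half_edge_def insert_commute[of b a])
      then show ?thesis using ab by blast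
    next
      case 2
      then have "E = half_edge G x y" by (simp add: half_edge_def)
      then show ?thesis using 2 by blast
    qed
  qed
  show "?R \<subseteq> ?L"
  proof
    fix E assume "E \<in> ?R"
    then obtain x y where x: "x \<in> verts G" "y \<in> verts G" "x \<noteq> y" "E = half_edge G x y" by blast
    show "E \<in> ?L"
    proof (cases "{x, y} \<in> edges G")
      case True
      then have "E = {Inl x, Inr {x, y}}" using x by (simp add: half_edge_def)
      then show ?thesis using True unfolding central_graph_def by auto
    next
      case False
      then have "E = Inl ` {x, y}" "{x, y} \<in> edges (complement_graph G)"
        using x by (auto simp: half_edge_def complement_graph_def)
      then show ?thesis unfolding central_graph_def by (simp del: image_insert)
    qed
  qed
qed

lemma central_edges_at:
  assumes "simple_graph G" "x \<in> verts G"
  shows "{E \<in> edges (central_graph G). Inl x \<in> E} = half_edge G x ` (verts G - {x})"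
proof -
  have "half_edge G a b = half_edge G x b \<and> a = x \<or> half_edge G a b = half_edge G x a \<and> b = x"
    if "Inl x \<in> half_edge G a b" for a b
    using that by (auto simp: half_edge_def insert_commute split: if_splits)
  moreover have "Inl x \<in> half_edge G x b" for b by (simp add: half_edge_def)
  ultimately show ?thesis
    unfolding edges_central[OF assms(1)] using assms(2) by blast
qed

lemma central_edges_at_subdivision:
  assumes "simple_graph G" "{x, y} \<in> edges G"
  shows "{E \<in> edges (central_graph G). Inr {x, y} \<in> E} = {half_edge G x y, half_edge G y x}"
proof -
  have "x \<in> verts G" "y \<in> verts G" "x \<noteq> y"
    using assms by (auto simp: simple_graph_def)
  moreover have "a = x \<and> b = y \<or> a = y \<and> b = x" if "Inr {x, y} \<in> half_edge G a b" for a b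
    using that by (auto simp: half_edge_def doubleton_eq_iff split: if_splits)
  moreover have "Inr {x, y} \<in> half_edge G x y" "Inr {x, y} \<in> half_edge G y x"
    using assms(2) by (simp_all add: half_edge_def insert_commute)
  ultimately show ?thesis
    unfolding edges_central[OF assms(1)] by blast
qed

text \<open>The half-edges from \<open>x\<close> to the other vertices are distinct, which gives
  degree \<open>order G - 1\<close>. A subdivision vertex has degree at most 2, and order at least 3
  keeps it from exceeding this value.\<close>

lemma max_degree_central:
  assumes G: "simple_graph G" and n: "order G \<ge> 3"
  shows "max_degree (central_graph G) = order G - 1"
proof -
  have fin: "finite (verts G)" using G by (simp add: simple_graph_def)
  have inl: "degree (central_graph G) (Inl x) = order G - 1" if "x \<in> verts G" for x
  proof -
    have "inj_on (half_edge G x) (verts G - {x})"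
      by (rule inj_onI) (metis half_edge_eqD)
    then show ?thesis
      using that fin by (simp add: degree_def central_edges_at[OF G that] card_image order_def)
  qed
  have inr: "degree (central_graph G) (Inr e) \<le> 2" if e: "e \<in> edges G" for e
  proof -
    obtain x y where "e = {x, y}" using edge_obtain[OF G e] by metis
    then show ?thesis
      using e by (simp add: degree_def central_edges_at_subdivision[OF G] card_insert_if)
  qed
  have v: "verts (central_graph G) = Inl ` verts G \<union> Inr ` edges G"
    by (simp add: central_graph_def)
  have "verts G \<noteq> {}" using n by (auto simp: order_def)
  then obtain x where "x \<in> verts G" by blast
  show ?thesis
    unfolding max_degree_def
  proof (rule Max_eqI)
    show "finite (degree (central_graph G) ` verts (central_graph G))"
      using fin simple_graph_finite_edges[OF G] by (simp add: v)
    show "order G - 1 \<in> degree (central_graph G) ` verts (central_graph G)"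
      using inl[OF \<open>x \<in> verts G\<close>] \<open>x \<in> verts G\<close> by (force simp: v)
    show "d \<le> order G - 1" if "d \<in> degree (central_graph G) ` verts (central_graph G)" for d
      using that inl inr n by (force simp: v)
  qed
qed

section \<open>Passage between AVD-total colourings and half-edge colourings\<close>

text \<open>The edges at \<open>Inl x\<close> are exactly the half-edges from \<open>x\<close>, so
  \<open>palette\<close> is the colour set of an original vertex.\<close>

lemma color_set_central:
  assumes "simple_graph G" "x \<in> verts G"
  shows "color_set (central_graph G) f (Inl x) =
    palette (verts G) (\<lambda>x. f (Inl (Inl x))) (\<lambda>x y. f (Inr (half_edge G x y))) x"
proof -
  have "{f (Inr {Inl x, w}) |w. {Inl x, w} \<in> edges (central_graph G)} =
    (\<lambda>E. f (Inr E)) ` {E \<in> edges (central_graph G). Inl x \<in> E}"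
  proof (intro equalityI subsetI)
    fix c assume "c \<in> (\<lambda>E. f (Inr E)) ` {E \<in> edges (central_graph G). Inl x \<in> E}"
    then obtain E where E: "E \<in> edges (central_graph G)" "Inl x \<in> E" "c = f (Inr E)" by blast
    then obtain a b where "E = {a, b}"
      using edge_obtain[OF simple_graph_central[OF assms(1)]] by metis
    then have "\<exists>w. E = {Inl x, w}" using E(2) by (auto simp: insert_commute)
    then show "c \<in> {f (Inr {Inl x, w}) |w. {Inl x, w} \<in> edges (central_graph G)}"
      using E by blast
  qed auto
  then show ?thesis
    by (simp add: color_set_def palette_def central_edges_at[OF assms] image_image)
qed

text \<open>The colours of the subdivision vertices are forgotten. On a non-adjacent pair both
  orders name the same edge, hence the symmetry; the other conditions are instances of properness or
  of the distinguishing property on complement edges.\<close>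

lemma half_edge_coloring_of_avd:
  assumes G: "simple_graph G" and f: "avd_total_coloring (central_graph G) f"
  shows "half_edge_coloring G (f ` elements (central_graph G))
    (\<lambda>x. f (Inl (Inl x))) (\<lambda>x y. f (Inr (half_edge G x y)))"
proof -
  let ?H = "central_graph G"
  have el: "Inl (Inl x) \<in> elements ?H" if "x \<in> verts G" for x
    using that by (simp add: elements_def central_graph_def)
  have ed: "half_edge G x y \<in> edges ?H" if "x \<in> verts G" "y \<in> verts G" "x \<noteq> y" for x y
    using that edges_central[OF G] by blast
  then have el2: "Inr (half_edge G x y) \<in> elements ?H" if "x \<in> verts G" "y \<in> verts G" "x \<noteq> y" for x y
    using that by (simp add: elements_def)
  have proper: "f s \<noteq> f t" if "s \<in> elements ?H" "t \<in> elements ?H" "adjacent_or_incident ?H s t" for s t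
    using f that by (simp add: avd_total_coloring_def proper_total_coloring_def)
  have avd: "color_set ?H f u \<noteq> color_set ?H f v" if "{u, v} \<in> edges ?H" for u v
    using f that by (simp add: avd_total_coloring_def)
  have mem: "Inl x \<in> half_edge G x y" for x y by (simp add: half_edge_def)
  have 1: "f (Inr (half_edge G x y)) \<noteq> f (Inl (Inl x))"
    if "x \<in> verts G" "y \<in> verts G" "x \<noteq> y" for x y
    using that mem by (intro proper el el2) auto
  have 2: "y = z" if "f (Inr (half_edge G x y)) = f (Inr (half_edge G x z))"
    "x \<in> verts G" "y \<in> verts G" "z \<in> verts G" "x \<noteq> y" "x \<noteq> z" for x y z
  proof (rule ccontr)
    assume "y \<noteq> z"
    then have "half_edge G x y \<noteq> half_edge G x z" using half_edge_eqD that(5,6) by metis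
    then have "f (Inr (half_edge G x y)) \<noteq> f (Inr (half_edge G x z))"
      using that mem[of x y] mem[of x z] by (intro proper el2) (simp_all, blast)
    then show False using that by simp
  qed
  have 3: "f (Inr (half_edge G x y)) \<noteq> f (Inr (half_edge G y x))"
    if "x \<in> verts G" "y \<in> verts G" "x \<noteq> y" "{x, y} \<in> edges G" for x y
    using that by (intro proper el2) (auto simp: half_edge_def insert_commute doubleton_eq_iff)
  have 4: "f (Inr (half_edge G x y)) = f (Inr (half_edge G y x))" if "{x, y} \<notin> edges G" for x y
    using that by (auto simp: half_edge_def insert_commute)
  have 5: "{Inl x, Inl y} \<in> edges ?H" if "x \<in> verts G" "y \<in> verts G" "x \<noteq> y" "{x, y} \<notin> edges G" for x y
    using ed[OF that(1-3)] that(4) by (simp add: half_edge_def)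
  have 6: "f (Inl (Inl x)) \<noteq> f (Inl (Inl y))"
    if "x \<in> verts G" "y \<in> verts G" "x \<noteq> y" "{x, y} \<notin> edges G" for x y
    using that 5 by (intro proper el) auto
  show ?thesis
    unfolding half_edge_coloring_def
  proof (intro conjI ballI impI)
    fix x assume x: "x \<in> verts G"
    show "f (Inl (Inl x)) \<in> f ` elements ?H" using el[OF x] by blast
    show "inj_on (\<lambda>y. f (Inr (half_edge G x y))) (verts G - {x})"
      using 2 x by (auto simp: inj_on_def)
    show "(\<lambda>y. f (Inr (half_edge G x y))) ` (verts G - {x}) \<subseteq> f ` elements ?H - {f (Inl (Inl x))}"
      using 1[OF x] el2[OF x] by auto
    fix y assume y: "y \<in> verts G" "x \<noteq> y"
    show "if {x, y} \<in> edges G then f (Inr (half_edge G x y)) \<noteq> f (Inr (half_edge G y x))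
      else f (Inr (half_edge G x y)) = f (Inr (half_edge G y x)) \<and>
        f (Inl (Inl x)) \<noteq> f (Inl (Inl y)) \<and>
        palette (verts G) (\<lambda>x. f (Inl (Inl x))) (\<lambda>x y. f (Inr (half_edge G x y))) x \<noteq>
        palette (verts G) (\<lambda>x. f (Inl (Inl x))) (\<lambda>x y. f (Inr (half_edge G x y))) y"
      using 3[OF x y] 4[of x y] 6[OF x y] avd[OF 5[OF x y]] color_set_central[OF G x, of f] color_set_central[OF G y(1), of f]
      by simp
  qed
qed

lemma half_edge_coloring_of_tcc:
  assumes G: "simple_graph G" "order G \<ge> 3" and tcc: "satisfies_avd_tcc (central_graph G)"
  shows "\<exists>v h. half_edge_coloring G {..<order G + 2} v h"
proof -
  let ?H = "central_graph G"
  let ?P = "\<lambda>k. \<exists>f. avd_total_coloring ?H f \<and> card (f ` elements ?H) = k"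
  have H: "simple_graph ?H" using simple_graph_central[OF G(1)] .
  \<comment> \<open>Some AVD-total colouring exists, so the least number of colours is attained and
    the bound yields an actual colouring.\<close>
  obtain k where "?P k" using avd_total_coloring_exists[OF H] by blast
  then have "?P (avd_total_chromatic_number ?H)"
    unfolding avd_total_chromatic_number_def by (rule LeastI)
  then obtain f where f: "avd_total_coloring ?H f"
    "card (f ` elements ?H) = avd_total_chromatic_number ?H" by blast
  have "finite (elements ?H)"
    using H simple_graph_finite_edges[OF H] by (simp add: elements_def simple_graph_def)
  moreover have "card (f ` elements ?H) \<le> order G + 2"
    using tcc f(2) G(2) max_degree_central[OF G] by (simp add: satisfies_avd_tcc_def)
  ultimately show ?thesis
    using half_edge_coloring_lessThan[OF half_edge_coloring_of_avd[OF G(1) f(1)]] by blast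
qed

text \<open>For order 3 the palette of an original vertex could coincide with the three colours at a
  subdivision vertex, hence the bound 4.\<close>
lemma tcc_of_half_edge_coloring:
  fixes G :: "'a sgraph"
  assumes G: "simple_graph G" and n: "order G \<ge> 4"
    and h: "half_edge_coloring G {..<order G + 2} v h"
  shows "satisfies_avd_tcc (central_graph G)"
proof -
  let ?H = "central_graph G" and ?k = "order G + 2"
  let ?col = "\<lambda>e. {v x |x. x \<in> e} \<union> {h x y |x y. x \<in> e \<and> y \<in> e \<and> x \<noteq> y}"
  have fin: "finite (verts G)" using G by (simp add: simple_graph_def)
  note d = half_edge_coloringD[OF h]
  \<comment> \<open>The colour of the subdivision vertex of \<open>e\<close> must avoid the two end
    vertices and the two halves: at most four colours are forbidden, and at least six are
    available.\<close>
  define c where "c e = (SOME c. c < ?k \<and> c \<notin> ?col e)" for e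
  have c: "c e < ?k \<and> c e \<notin> ?col e" if "e \<in> edges G" for e
  proof -
    obtain x y where e: "e = {x, y}" using edge_obtain[OF G \<open>e \<in> edges G\<close>] by metis
    let ?L = "[v x, v y, h x y, h y x]"
    have L: "?col e \<subseteq> set ?L"
      by (auto simp: e)
    have "card (set ?L) < card {..<?k}"
      using card_length[of ?L] n by simp
    then have "\<not> {..<?k} \<subseteq> set ?L"
      using card_mono[OF finite_set, of "{..<?k}" ?L] by linarith
    then have "\<exists>c. c < ?k \<and> c \<notin> ?col e" using L by blast
    then show ?thesis unfolding c_def by (rule someI_ex)
  qed
  have cv: "v x \<noteq> c e" if "e \<in> edges G" "x \<in> e" for x e
    using c[OF that(1)] that(2) by auto
  have ch: "h x y \<noteq> c e" if "e \<in> edges G" "x \<in> e" "y \<in> e" "x \<noteq> y" for x y e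
    using c[OF that(1)] that(2-) by auto
  \<comment> \<open>The colour of an edge of the central graph is read off from any ordered pair
    naming it; by \<open>half_edge_eqD\<close> and the symmetry of \<open>h\<close> on non-adjacent
    pairs the choice does not matter.\<close>
  define g where "g E = (SOME a. \<exists>x\<in>verts G. \<exists>y\<in>verts G. x \<noteq> y \<and> E = half_edge G x y \<and> a = h x y)" for E
  have g: "g (half_edge G x y) = h x y" if "x \<in> verts G" "y \<in> verts G" "x \<noteq> y" for x y
  proof -
    have "\<exists>a. \<exists>x'\<in>verts G. \<exists>y'\<in>verts G. x' \<noteq> y' \<and> half_edge G x y = half_edge G x' y' \<and> a = h x' y'"
      using that by blast
    from someI_ex[OF this] obtain x' y' where *: "half_edge G x y = half_edge G x' y'"
      "g (half_edge G x y) = h x' y'" unfolding g_def by blast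
    show ?thesis
      using half_edge_eqD[OF *(1)] *(2) d(5)[of x y] that by auto
  qed
  define f where "f s = (case s of Inl (Inl x) \<Rightarrow> v x | Inl (Inr e) \<Rightarrow> c e | Inr E \<Rightarrow> g E)" for s
  have f: "f (Inl (Inl x)) = v x" "f (Inl (Inr e)) = c e" "f (Inr E) = g E" for x e E
    by (simp_all add: f_def)
  have vertsH: "u \<in> verts ?H \<longleftrightarrow> u \<in> Inl ` verts G \<or> u \<in> Inr ` edges G" for u
    by (simp add: central_graph_def)
  have edge_at: "\<exists>y\<in>verts G. y \<noteq> x \<and> E = half_edge G x y"
    if "E \<in> edges ?H" "Inl x \<in> E" for x E
  proof -
    have "x \<in> verts G"
      using that simple_graph_central[OF G] vertsH[of "Inl x"] unfolding simple_graph_def by blast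
    then show ?thesis using central_edges_at[OF G] that by blast
  qed
  have endp: "x \<in> verts G" if "E \<in> edges ?H" "Inl x \<in> E" for x E
    using that simple_graph_central[OF G] vertsH[of "Inl x"] unfolding simple_graph_def by blast
  have sub_at: "\<exists>x\<in>verts G. \<exists>y\<in>verts G. x \<noteq> y \<and> e = {x, y} \<and> E = half_edge G x y \<and> {x, y} \<in> edges G"
    if E: "E \<in> edges ?H" "Inr e \<in> E" for e E
  proof -
    obtain a b where ab: "E = half_edge G a b" "a \<in> verts G" "b \<in> verts G" "a \<noteq> b"
      using E(1) unfolding edges_central[OF G] by blast
    then have "e = {a, b} \<and> {a, b} \<in> edges G"
      using E(2) by (auto simp: half_edge_def split: if_splits)
    then show ?thesis using ab by blast
  qed
  have adj: "x \<in> verts G \<and> y \<in> verts G \<and> x \<noteq> y \<and> {x, y} \<notin> edges G" if E: "{Inl x, Inl y} \<in> edges ?H" for x y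
  proof -
    obtain a b where ab: "{Inl x, Inl y} = half_edge G a b" "a \<in> verts G" "b \<in> verts G" "a \<noteq> b"
      using E unfolding edges_central[OF G] by blast
    then have "{a, b} \<notin> edges G" "{a, b} = {x, y}"
      by (auto simp: half_edge_def doubleton_eq_iff split: if_splits)
    then show ?thesis using ab(2-4) by (auto simp: doubleton_eq_iff)
  qed
  have vv: "f (Inl u) \<noteq> f (Inl w)" if uw: "{u, w} \<in> edges ?H" for u w
  proof -
    have *: "v x \<noteq> c e" if E: "{Inl x, Inr e} \<in> edges ?H" for x e
    proof -
      obtain a b where ab: "e = {a, b}" "{Inl x, Inr e} = half_edge G a b" "{a, b} \<in> edges G"
        using sub_at[OF E] by blast
      then have "x \<in> e" "e \<in> edges G" by (auto simp: half_edge_def)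
      then show ?thesis using cv by blast
    qed
    \<comment> \<open>No two subdivision vertices are adjacent, so the independent choices of
      \<open>c\<close> cannot clash.\<close>
    have **: False if "{Inr e, Inr e'} \<in> edges ?H" for e e'
      using that unfolding edges_central[OF G] half_edge_def by (auto split: if_splits)
    show ?thesis
    proof (cases u)
      case u: (Inl x)
      show ?thesis
      proof (cases w)
        case (Inl y) then show ?thesis using u uw adj d(5) by (auto simp: f)
      next
        case (Inr e) then show ?thesis using u uw * by (auto simp: f)
      qed
    next
      case u: (Inr e)
      show ?thesis
      proof (cases w)
        case (Inl y) then show ?thesis using u uw *[of y e] by (auto simp: f insert_commute)
      next
        case (Inr e') then show ?thesis using u uw ** by auto
      qed
    qed
  qed
  have ve: "f (Inl u) \<noteq> f (Inr E)" if E: "E \<in> edges ?H" "u \<in> E" for u E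
  proof (cases u)
    case (Inl x)
    then obtain y where "y \<in> verts G" "y \<noteq> x" "E = half_edge G x y" using edge_at E by blast
    then show ?thesis using endp[of E x] E Inl d(3)[of x y] by (auto simp: f g)
  next
    case (Inr e)
    then obtain x y where "x \<in> verts G" "y \<in> verts G" "x \<noteq> y" "e = {x, y}" "E = half_edge G x y"
      "{x, y} \<in> edges G" using sub_at E by blast
    then show ?thesis using ch[of e x y] Inr by (auto simp: f g)
  qed
  have ee: "f (Inr E) \<noteq> f (Inr E')" if E: "E \<in> edges ?H" "E' \<in> edges ?H" "u \<in> E" "u \<in> E'" "E \<noteq> E'" for u E E'
  proof (cases u)
    case (Inl x)
    obtain y where y: "y \<in> verts G" "y \<noteq> x" "E = half_edge G x y" using edge_at E Inl by blast
    obtain z where z: "z \<in> verts G" "z \<noteq> x" "E' = half_edge G x z" using edge_at E Inl by blast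
    have x: "x \<in> verts G" using endp E Inl by blast
    show ?thesis using y z x E(5) inj_onD[OF d(2)[OF x], of y z] by (auto simp: f g)
  next
    case (Inr e)
    obtain x y where x: "x \<in> verts G" "y \<in> verts G" "x \<noteq> y" "e = {x, y}" "E = half_edge G x y"
      "{x, y} \<in> edges G" using sub_at E Inr by blast
    obtain x' y' where x': "x' \<in> verts G" "y' \<in> verts G" "x' \<noteq> y'" "e = {x', y'}" "E' = half_edge G x' y'"
      "{x', y'} \<in> edges G" using sub_at E Inr by blast
    have "x' = y" "y' = x" using x x' E(5) by (auto simp: doubleton_eq_iff)
    then show ?thesis using x x' d(4)[of x y] by (auto simp: f g)
  qed
  have proper: "proper_total_coloring ?H f"
    unfolding proper_total_coloring_def
  proof (intro ballI impI)
    fix s t assume st: "s \<in> elements ?H" "t \<in> elements ?H" "adjacent_or_incident ?H s t"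
    show "f s \<noteq> f t"
    proof (cases s)
      case s: (Inl u)
      show ?thesis using st s vv ve by (cases t) (auto simp: elements_def)
    next
      case s: (Inr E)
      show ?thesis using st s ve[of E, symmetric] ee[of E] by (cases t) (auto simp: elements_def)
    qed
  qed
  have pal: "color_set ?H f (Inl x) = palette (verts G) v h x" if "x \<in> verts G" for x
  proof -
    have "(\<lambda>y. g (half_edge G x y)) ` (verts G - {x}) = h x ` (verts G - {x})"
      using that by (intro image_cong) (auto simp: g)
    then show ?thesis unfolding color_set_central[OF G that] by (simp add: palette_def f)
  qed
  have card_pal: "card (palette (verts G) v h x) = order G" if "x \<in> verts G" for x
    unfolding order_def using d(3)[OF that] by (intro card_palette fin that d(2)) force
  \<comment> \<open>A subdivision vertex sees at most its own colour and those of its two halves, so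
    cardinality alone separates it from an original vertex.\<close>
  have card_sub: "card (color_set ?H f (Inr e)) \<le> 3" if "e \<in> edges G" for e
  proof -
    obtain x y where e: "e = {x, y}" using edge_obtain[OF G \<open>e \<in> edges G\<close>] by metis
    have xy: "{x, y} \<in> edges G" using that e by simp
    have "{Inr e, w} \<in> {half_edge G x y, half_edge G y x}" if "{Inr e, w} \<in> edges ?H" for w
      using that unfolding central_edges_at_subdivision[OF G xy, symmetric] by (simp add: e)
    then have "g {Inr e, w} \<in> {g (half_edge G x y), g (half_edge G y x)}"
      if "{Inr e, w} \<in> edges ?H" for w
      using that by (metis insert_iff singletonD)
    then have "color_set ?H f (Inr e) \<subseteq> set [c e, g (half_edge G x y), g (half_edge G y x)]"
      unfolding color_set_def f by auto
    then have "card (color_set ?H f (Inr e)) \<le> length [c e, g (half_edge G x y), g (half_edge G y x)]"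
      by (meson List.finite_set card_length card_mono le_trans)
    then show ?thesis by simp
  qed
  have avd: "color_set ?H f u \<noteq> color_set ?H f w" if uw: "{u, w} \<in> edges ?H" for u w
  proof -
    obtain x y where x: "{u, w} = half_edge G x y" "x \<in> verts G" "y \<in> verts G" "x \<noteq> y"
      using uw unfolding edges_central[OF G] by blast
    show ?thesis
    proof (cases "{x, y} \<in> edges G")
      case True
      then have "color_set ?H f (Inl x) \<noteq> color_set ?H f (Inr {x, y})"
        using pal[OF x(2)] card_pal[OF x(2)] card_sub[OF True] n by auto
      then show ?thesis using x True by (auto simp: half_edge_def doubleton_eq_iff)
    next
      case False
      then show ?thesis using x pal d(5)[of x y] by (auto simp: half_edge_def doubleton_eq_iff)
    qed
  qed
  have "f ` elements ?H \<subseteq> {..<?k}"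
  proof -
    have "g E < ?k" if E: "E \<in> edges ?H" for E
    proof -
      obtain x y where x: "E = half_edge G x y" "x \<in> verts G" "y \<in> verts G" "x \<noteq> y"
        using E unfolding edges_central[OF G] by blast
      then show ?thesis using d(3)[of x y] by (auto simp: g)
    qed
    moreover have "v x < ?k" if "x \<in> verts G" for x using d(1)[OF that] by simp
    ultimately show ?thesis using c by (auto simp: elements_def f vertsH)
  qed
  then have "card (f ` elements ?H) \<le> ?k"
    using card_mono[of "{..<?k}"] by fastforce
  moreover have "avd_total_chromatic_number ?H \<le> card (f ` elements ?H)"
    unfolding avd_total_chromatic_number_def
    by (rule Least_le) (use proper avd in \<open>auto simp: avd_total_coloring_def\<close>)
  ultimately show ?thesis
    using n max_degree_central[OF G] by (simp add: satisfies_avd_tcc_def)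
qed

subsection \<open>Joins\<close>

lemma verts_join: "verts (join_graph G H) = Inl ` verts G \<union> Inr ` verts H"
  by (simp add: join_graph_def)

lemma edges_join:
  "{Inl x, Inl x'} \<in> edges (join_graph G H) \<longleftrightarrow> {x, x'} \<in> edges G"
  "{Inr y, Inr y'} \<in> edges (join_graph G H) \<longleftrightarrow> {y, y'} \<in> edges H"
  "{Inl x, Inr y} \<in> edges (join_graph G H) \<longleftrightarrow> x \<in> verts G \<and> y \<in> verts H"
  "{Inr y, Inl x} \<in> edges (join_graph G H) \<longleftrightarrow> x \<in> verts G \<and> y \<in> verts H"
proof -
  have E: "E \<in> edges (join_graph G H) \<longleftrightarrow> (\<exists>e\<in>edges G. E = Inl ` e) \<or> (\<exists>e\<in>edges H. E = Inr ` e) \<or>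
      (\<exists>x\<in>verts G. \<exists>y\<in>verts H. E = {Inl x, Inr y})" for E
    unfolding join_graph_def by auto
  have "{Inl x, Inl x'} = Inl ` e \<longleftrightarrow> {x, x'} = e" for e :: "'a set"
    using inj_image_eq_iff[OF inj_Inl, of "{x, x'}" e] by simp
  moreover have "{Inl x, Inl x'} \<noteq> Inr ` e" "{Inl x, Inl x'} \<noteq> {Inl z, Inr y}" for e and y z
    by auto
  ultimately show "{Inl x, Inl x'} \<in> edges (join_graph G H) \<longleftrightarrow> {x, x'} \<in> edges G"
    unfolding E by metis
  have "{Inr y, Inr y'} = Inr ` e \<longleftrightarrow> {y, y'} = e" for e :: "'b set"
    using inj_image_eq_iff[OF inj_Inr, of "{y, y'}" e] by simp
  moreover have "{Inr y, Inr y'} \<noteq> Inl ` e" "{Inr y, Inr y'} \<noteq> {Inl z, Inr w}" for e and w z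
    by auto
  ultimately show "{Inr y, Inr y'} \<in> edges (join_graph G H) \<longleftrightarrow> {y, y'} \<in> edges H"
    unfolding E by metis
  have "{Inl x, Inr y} \<noteq> Inl ` e" "{Inl x, Inr y} \<noteq> Inr ` e'" for e e'
    by auto
  moreover have "{Inl x, Inr y} = {Inl z, Inr w} \<longleftrightarrow> x = z \<and> y = w" for z w
    by (auto simp: doubleton_eq_iff)
  ultimately show "{Inl x, Inr y} \<in> edges (join_graph G H) \<longleftrightarrow> x \<in> verts G \<and> y \<in> verts H"
    unfolding E by metis
  then show "{Inr y, Inl x} \<in> edges (join_graph G H) \<longleftrightarrow> x \<in> verts G \<and> y \<in> verts H"
    by (simp add: insert_commute)
qed

lemma order_join:
  assumes "simple_graph G" "simple_graph H"
  shows "order (join_graph G H) = order G + order H"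
proof -
  have "Inl ` verts G \<inter> Inr ` verts H = {}" by auto
  then show ?thesis
    using assms by (simp add: order_def verts_join simple_graph_def card_Un_disjoint card_image)
qed

lemma numbering:
  assumes "finite V"
  obtains e :: "'a \<Rightarrow> nat" where "bij_betw e V {..<card V}"
  using ex_bij_betw_finite_nat[OF assms] by (auto simp: lessThan_atLeast0)

text \<open>The colours used inside \<open>G\<close> and inside \<open>H\<close> overlap in two, so that each side has its own
  disjoint supply of colours for the ends of the edges joining \<open>G\<close> and \<open>H\<close>.\<close>
lemma half_edge_coloring_join:
  fixes G :: "'a sgraph" and H :: "'b sgraph"
  assumes G: "simple_graph G" and H: "simple_graph H"
    and g: "half_edge_coloring G {..<order G + 2} vG hG"
    and h: "half_edge_coloring H {..<order H + 2} vH hH"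
  shows "\<exists>v h. half_edge_coloring (join_graph G H) {..<order (join_graph G H) + 2} v h"
proof -
  define m n where "m = order G" and "n = order H"
  obtain a where a: "bij_betw a (verts G) {..<m}"
    using numbering[of "verts G"] G by (auto simp: simple_graph_def m_def order_def)
  obtain b where b: "bij_betw b (verts H) {..<n}"
    using numbering[of "verts H"] H by (auto simp: simple_graph_def n_def order_def)
  have al: "a x < m" if "x \<in> verts G" for x using a that by (auto simp: bij_betw_def)
  have bl: "b y < n" if "y \<in> verts H" for y using b that by (auto simp: bij_betw_def)
  have ai: "a x = a x' \<longleftrightarrow> x = x'" if "x \<in> verts G" "x' \<in> verts G" for x x'
    using a that by (auto simp: bij_betw_def inj_on_def)
  have bi: "b x = b x' \<longleftrightarrow> x = x'" if "x \<in> verts H" "x' \<in> verts H" for x x'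
    using b that by (auto simp: bij_betw_def inj_on_def)
  note dG = half_edge_coloringD[OF g, folded m_def] and dH = half_edge_coloringD[OF h, folded n_def]
  define v :: "'a + 'b \<Rightarrow> nat" where "v = case_sum vG (\<lambda>y. m + vH y)"
  \<comment> \<open>Inside \<open>G\<close> the colours below \<open>m + 2\<close> are used, inside
    \<open>H\<close> those from \<open>m\<close> to \<open>m + n + 1\<close>. A joining edge gets at
    its end in \<open>G\<close> a colour from \<open>m + 2\<close> on and at its end in
    \<open>H\<close> a colour below \<open>m\<close>, in both cases determined by the number of the
    opposite vertex. So its two ends always differ.\<close>
  define k where "k = case_sum (\<lambda>x. case_sum (\<lambda>x'. hG x x') (\<lambda>y. m + 2 + b y))
    (\<lambda>y. case_sum (\<lambda>x. a x) (\<lambda>y'. m + hH y y'))"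
  have ks: "k (Inl x) (Inl x') = hG x x'" "k (Inl x) (Inr y) = m + 2 + b y"
    "k (Inr y) (Inl x) = a x" "k (Inr y) (Inr y') = m + hH y y'" "v (Inl x) = vG x" "v (Inr y) = m + vH y"
    for x x' y y'
    by (simp_all add: k_def v_def)
  have DG: "verts (join_graph G H) - {Inl x} = Inl ` (verts G - {x}) \<union> Inr ` verts H" for x
    by (auto simp: verts_join)
  have DH: "verts (join_graph G H) - {Inr y} = Inl ` verts G \<union> Inr ` (verts H - {y})" for y
    by (auto simp: verts_join)
  have palG: "palette (verts (join_graph G H)) v k (Inl x) = palette (verts G) vG hG x \<union> (\<lambda>y. m + 2 + b y) ` verts H" for x
    unfolding palette_def DG image_Un image_image ks by simp
  have palH: "palette (verts (join_graph G H)) v k (Inr y) = a ` verts G \<union> (\<lambda>c. m + c) ` palette (verts H) vH hH y" for y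
    unfolding palette_def DH image_Un image_image ks by auto
  have pG: "palette (verts G) vG hG x \<subseteq> {..<m + 2}" if "x \<in> verts G" for x
    using dG(1,3)[OF that] by (auto simp: palette_def)
  \<comment> \<open>The palette inside a part can be recovered from the palette in the join, by
    cutting at \<open>m + 2\<close> for \<open>G\<close> and by shifting back by \<open>m\<close>
    for \<open>H\<close>; hence different palettes stay different.\<close>
  have palGD: "palette (verts G) vG hG x = palette (verts (join_graph G H)) v k (Inl x) \<inter> {..<m + 2}"
    if "x \<in> verts G" for x
    using pG[OF that] by (auto simp: palG)
  have palHD: "palette (verts H) vH hH y = {c. m + c \<in> palette (verts (join_graph G H)) v k (Inr y)}"
    if "y \<in> verts H" for y
    using al by (force simp: palH)
  have vG: "vG x < m + 2" if "x \<in> verts G" for x using dG(1)[OF that] by simp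
  have vH: "vH y < n + 2" if "y \<in> verts H" for y using dH(1)[OF that] by simp
  have hG: "hG x x' < m + 2 \<and> hG x x' \<noteq> vG x" if "x \<in> verts G" "x' \<in> verts G - {x}" for x x'
    using dG(3)[OF that(1), of x'] that(2) by simp
  have hH: "hH y y' < n + 2 \<and> hH y y' \<noteq> vH y" if "y \<in> verts H" "y' \<in> verts H - {y}" for y y'
    using dH(3)[OF that(1), of y'] that(2) by simp
  have hG_ne: "hG x x' \<noteq> m + 2 + c" if "x \<in> verts G" "x' \<in> verts G - {x}" for x x' c
    using hG[OF that] by simp
  have hG_eq: "hG x p = hG x q \<longleftrightarrow> p = q" if "x \<in> verts G" "p \<in> verts G - {x}" "q \<in> verts G - {x}" for x p q
    using inj_on_eq_iff[OF dG(2)[OF that(1)]] that(2,3) by blast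
  have hH_eq: "hH x p = hH x q \<longleftrightarrow> p = q" if "x \<in> verts H" "p \<in> verts H - {x}" "q \<in> verts H - {x}" for x p q
    using inj_on_eq_iff[OF dH(2)[OF that(1)]] that(2,3) by blast
  have a_ne: "a x \<noteq> m + c" if "x \<in> verts G" for x c using al[OF that] by simp
  have "half_edge_coloring (join_graph G H) {..<m + n + 2} v k"
    unfolding half_edge_coloring_def
  proof (intro conjI ballI impI)
    fix u assume u: "u \<in> verts (join_graph G H)"
    then consider (l) x where "u = Inl x" "x \<in> verts G" | (r) y where "u = Inr y" "y \<in> verts H"
      by (auto simp: verts_join)
    note cu = this
    show "v u \<in> {..<m + n + 2}"
      using cu
    proof cases
      case l
      then show ?thesis using vG[OF l(2)] by (simp add: ks)
    next
      case r
      then show ?thesis using vH[OF r(2)] by (simp add: ks)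
    qed
    show "inj_on (k u) (verts (join_graph G H) - {u})"
      using cu
    proof cases
      case l
      show ?thesis
      proof (rule inj_onI)
        fix p q assume "p \<in> verts (join_graph G H) - {u}" "q \<in> verts (join_graph G H) - {u}" "k u p = k u q"
        then show "p = q"
          unfolding l(1) DG using hG_eq[OF l(2)] hG_ne[OF l(2)] hG_ne[OF l(2), symmetric] bi
          by (elim UnE imageE) (simp_all add: ks)
      qed
    next
      case r
      show ?thesis
      proof (rule inj_onI)
        fix p q assume "p \<in> verts (join_graph G H) - {u}" "q \<in> verts (join_graph G H) - {u}" "k u p = k u q"
        then show "p = q"
          unfolding r(1) DH using hH_eq[OF r(2)] a_ne a_ne[symmetric] ai
          by (elim UnE imageE) (simp_all add: ks)
      qed
    qed
    show "k u ` (verts (join_graph G H) - {u}) \<subseteq> {..<m + n + 2} - {v u}"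
      using cu
    proof cases
      case l
      have "k u p < m + n + 2 \<and> k u p \<noteq> v u" if "p \<in> verts (join_graph G H) - {u}" for p
        using that vG[OF l(2)] hG[OF l(2)] bl unfolding l(1) DG
        by (elim UnE imageE) (force simp: ks)+
      then show ?thesis by auto
    next
      case r
      have "k u p < m + n + 2 \<and> k u p \<noteq> v u" if "p \<in> verts (join_graph G H) - {u}" for p
        using that vH[OF r(2)] hH[OF r(2)] al unfolding r(1) DH
        by (elim UnE imageE) (force simp: ks)+
      then show ?thesis by auto
    qed
    fix w assume w: "w \<in> verts (join_graph G H)" "u \<noteq> w"
    let ?J = "join_graph G H"
    show "if {u, w} \<in> edges ?J then k u w \<noteq> k w u
      else k u w = k w u \<and> v u \<noteq> v w \<and> palette (verts ?J) v k u \<noteq> palette (verts ?J) v k w"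
    proof (cases u; cases w)
      fix x x' assume "u = Inl x" "w = Inl x'"
      moreover from this have "x \<in> verts G" "x' \<in> verts G" "x \<noteq> x'" using u w by (auto simp: verts_join)
      ultimately show ?thesis
        using dG(4,5)[of x x'] palGD[of x] palGD[of x'] by (auto simp: ks edges_join)
    next
      fix y y' assume "u = Inr y" "w = Inr y'"
      moreover from this have "y \<in> verts H" "y' \<in> verts H" "y \<noteq> y'" using u w by (auto simp: verts_join)
      ultimately show ?thesis
        using dH(4,5)[of y y'] palHD[of y] palHD[of y'] by (auto simp: ks edges_join)
    next
      fix x y assume "u = Inl x" "w = Inr y"
      then show ?thesis using u w al[of x] by (auto simp: ks edges_join verts_join)
    next
      fix x y assume "u = Inr y" "w = Inl x"
      then show ?thesis using u w al[of x] by (auto simp: ks edges_join verts_join)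
    qed
  qed
  then show ?thesis
    unfolding order_join[OF G H] m_def n_def by blast
qed

text \<open>The join has order at least 6, so the bound 4 required for the step back to the central
  graph holds even if both parts have order 3.\<close>

lemma tcc_of_join:
  assumes "simple_graph G" "simple_graph H" "order G \<ge> 3" "order H \<ge> 3"
    and "\<exists>v h. half_edge_coloring G {..<order G + 2} v h"
    and "\<exists>v h. half_edge_coloring H {..<order H + 2} v h"
  shows "satisfies_avd_tcc (central_graph (join_graph G H))"
proof -
  obtain v h where "half_edge_coloring (join_graph G H) {..<order (join_graph G H) + 2} v h"
    using half_edge_coloring_join assms by blast
  then show ?thesis
    using assms(1-4) by (intro tcc_of_half_edge_coloring) (simp_all add: simple_graph_join order_join)
qed

subsection \<open>Particular graphs\<close>

lemma mod_add_cases: "i < p \<Longrightarrow> j < p \<Longrightarrow> (i + j) mod p = (if i + j < p then i + j else i + j - p)"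
  for i j p :: nat
  by (simp add: mod_if)

lemma mod_add_cancel: "i < p \<Longrightarrow> j < p \<Longrightarrow> l < p \<Longrightarrow> (i + j) mod p = (i + l) mod p \<longleftrightarrow> j = l"
  for i j l p :: nat
  by (auto simp: mod_add_cases split: if_splits)

text \<open>2 is invertible modulo an odd number. This makes the diagonal
  \<open>(i + i) mod p\<close> usable as a colouring of the vertices.\<close>

lemma mod_double_cancel: "odd p \<Longrightarrow> i < p \<Longrightarrow> j < p \<Longrightarrow> (i + i) mod p = (j + j) mod p \<longleftrightarrow> i = j"
  for i j p :: nat
  by (auto simp: mod_add_cases elim!: oddE split: if_splits; presburger)

text \<open>Every pair is an edge, so no vertex colours or palettes are compared, and the two ends
  of \<open>{i, j}\<close> carry the different colours \<open>j\<close> and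
  \<open>i\<close>.\<close>

lemma half_edge_coloring_complete:
  "\<exists>v h. half_edge_coloring (complete_graph n) {..<n + 2} v h"
proof -
  have "half_edge_coloring (complete_graph n) {..<n + 2} (\<lambda>i. i) (\<lambda>i j. j)"
    by (auto simp: half_edge_coloring_def complete_graph_def)
  then show ?thesis by blast
qed

text \<open>The central graph is a complete graph, coloured by addition modulo an odd
  \<open>p > n\<close>. Vertex \<open>i\<close> sees the residues of
  \<open>i, ..., i + n - 1\<close>, so that of \<open>i + n\<close> is missing.\<close>

lemma half_edge_coloring_edgeless:
  assumes G: "verts G = {..<n}" "edges G = {}"
  shows "\<exists>v h. half_edge_coloring G {..<n + 2 :: nat} v h"
proof -
  define p where "p = (if even n then n + 1 else n + 2)"
  have p: "odd p" "n < p" "p \<le> n + 2" by (auto simp: p_def)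
  have ltp: "(i + j) mod p < p" for i j
    using p by simp
  have lt: "(i + j) mod p < n + 2" for i j
    using ltp[of i j] p by linarith
  define b where "b i = (if even n then n + 1 else (i + (n + 1)) mod p)" for i
  have b: "b i < n + 2 \<and> b i \<noteq> (i + j) mod p" if "i < n" "j \<le> n" for i j
  proof (cases "even n")
    case True
    then show ?thesis using ltp[of i j] by (auto simp: b_def p_def simp del: mod_less_divisor)
  next
    case False
    then show ?thesis
      using that lt[of i "n + 1"] mod_add_cancel[of i p "n + 1" j] by (simp add: b_def p_def)
  qed
  have ne: "{(i + n) mod p, b i} \<noteq> {(j + n) mod p, b j}" if ij: "i < n" "j < n" "i \<noteq> j" for i j
  proof -
    have 1: "(i + n) mod p \<noteq> (j + n) mod p"
      using mod_add_cancel[of n p i j] p ij by (simp add: add.commute)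
    \<comment> \<open>The missing pairs could only agree crosswise. For even \<open>n\<close> this
      fails because \<open>b j\<close> is no residue; for odd \<open>n\<close> it would force both
      \<open>i = j + 1\<close> and \<open>j = i + 1\<close> modulo \<open>n + 2\<close>.\<close>
    have 2: "\<not> ((i + n) mod p = b j \<and> b i = (j + n) mod p)"
    proof (cases "even n")
      case True
      then have "b j = p" by (simp add: b_def p_def)
      then show ?thesis using ltp[of i n] by (metis less_irrefl)
    next
      case False
      then have p_eq: "p = n + 2" by (simp add: p_def)
      have "(l + n) mod p = (if l < 2 then l + n else l - 2)" if "l < n" for l
        using that mod_add_cases[of l p n] by (simp add: p_eq)
      moreover have "b l = (if l = 0 then n + 1 else l - 1)" if "l < n" for l
        using that False mod_add_cases[of l p "n + 1"] by (simp add: b_def p_eq)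
      ultimately show ?thesis using ij by (simp split: if_splits) linarith
    qed
    show ?thesis using 1 2 by (auto simp: doubleton_eq_iff)
  qed
  have "half_edge_coloring G {..<n + 2} (\<lambda>i. (i + i) mod p) (\<lambda>i j. (i + j) mod p)"
  proof (rule half_edge_coloringI_missing[where a = "\<lambda>i. (i + n) mod p" and b = b], goal_cases)
    case (4 i) show ?case using lt by simp
  next
    case (5 i j) then show ?case using lt mod_add_cancel[of i p j i] p by (simp add: G)
  next
    case (6 i j l) then show ?case using mod_add_cancel[of i p j l] p by (simp add: G)
  next
    case (7 i)
    then have i: "i < n" by (simp add: G)
    have "(i + n) mod p \<noteq> (i + i) mod p" using mod_add_cancel[of i p n i] p i by simp
    then show ?case
      using b[OF i, of i] b[OF i, of n] lt[of i n] i by simp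
  next
    case (8 i j)
    then show ?case using b[of i j] mod_add_cancel[of i p n j] p by (simp add: G)
  next
    case (10 i j)
    then have i: "i < n" "j < n" "i \<noteq> j" by (simp_all add: G)
    then show ?case
      using ne[OF i] p mod_double_cancel[of p i j] by (simp add: add.commute[of j i])
  qed (simp_all add: G)
  then show ?thesis by blast
qed

text \<open>The symmetric colouring \<open>i + j\<close> modulo an odd number is changed on every
  edge at one end only, the one at \<open>i\<close> towards its predecessor, so that the two ends
  differ. The residue \<open>2 * i - 1\<close> freed at \<open>i\<close> then tells the vertices
  apart; vertex 0 needs separate care.\<close>

lemma half_edge_coloring_path_or_cycle:
  fixes n :: nat and cyc :: bool
  assumes n: "n \<ge> 3" and V: "verts G = {..<n}"
    and E: "\<And>i j. i < n \<Longrightarrow> j < n \<Longrightarrow> {i, j} \<in> edges G \<longleftrightarrow>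
      i = Suc j \<or> j = Suc i \<or> cyc \<and> (i = 0 \<and> j = n - 1 \<or> j = 0 \<and> i = n - 1)"
  shows "\<exists>v h. half_edge_coloring G {..<n + 2 :: nat} v h"
proof -
  \<comment> \<open>This orients the edges. A vertex has at most one predecessor, so at most one
    half-edge at each vertex is recoloured.\<close>
  define pre where "pre i j \<longleftrightarrow> i = Suc j \<or> cyc \<and> i = 0 \<and> j = n - 1" for i j
  have E': "{i, j} \<in> edges G \<longleftrightarrow> pre i j \<or> pre j i" if "i < n" "j < n" for i j
    using E[OF that] by (auto simp: pre_def)
  have pre_asym: "pre i j \<Longrightarrow> \<not> pre j i" if "i < n" "j < n" for i j
    using that n by (auto simp: pre_def)
  have pre_unique: "pre i j \<Longrightarrow> pre i l \<Longrightarrow> j = l" for i j l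
    by (auto simp: pre_def)
  define pd where "pd i = (if i = 0 then n - 1 else i - 1)" for i
  have pd: "pd i < n \<and> pd i \<noteq> i" if "i < n" for i
    using that n by (auto simp: pd_def)
  have pre: "pre i j \<longleftrightarrow> j = pd i \<and> (i \<noteq> 0 \<or> cyc)" for i j
    by (auto simp: pre_def pd_def)
  show ?thesis
  proof (cases "even n")
    case False
    \<comment> \<open>For odd \<open>n\<close> the modulus is \<open>n\<close>, and each vertex sees
      all residues before the change. The replacement colour is \<open>n\<close>, so
      \<open>n + 1\<close> is missing everywhere and the other missing colour is the freed residue.
      The first vertex of a path frees nothing and misses \<open>n\<close> instead.\<close>
    define h where "h i j = (if pre i j then n else (i + j) mod n)" for i j
    define b where "b i = (if i = 0 \<and> \<not> cyc then n else (i + pd i) mod n)" for i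
    have lt: "(i + j) mod n < n" for i j using n by simp
    then have lt': "(i + j) mod n < n + 2" "(i + j) mod n \<noteq> n" "n \<noteq> (i + j) mod n" "n + 1 \<noteq> (i + j) mod n" for i j
      using lt[of i j] by linarith+
    have b_lt: "b i \<le> n" for i
      using lt by (auto simp: b_def less_imp_le simp del: mod_less_divisor)
    \<comment> \<open>The value is \<open>2 * i - 1\<close> modulo the odd \<open>n\<close>, written
      without subtraction below 0; it determines \<open>i\<close>.\<close>
    have val: "(i + pd i) mod n =
        (if i = 0 then n - 1 else if 2 * i \<le> n then 2 * i - 1 else 2 * i - 1 - n)" if "i < n" for i
      using that n mod_add_cases[of i n "i - 1"] by (cases i) (auto simp: pd_def)
    have b_inj: "b i \<noteq> b j" if "i < n" "j < n" "i \<noteq> j" for i j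
    proof -
      have "(i + pd i) mod n \<noteq> (j + pd j) mod n"
        using that False unfolding val[OF that(1)] val[OF that(2)]
        by (elim oddE) (auto split: if_splits; presburger)
      then show ?thesis
        using that(3) lt' unfolding b_def by metis
    qed
    have b_v: "b i \<noteq> (i + i) mod n" if "i < n" for i
      using lt'[of i i] mod_add_cancel[of i n "pd i" i] pd that by (simp add: b_def)
    have b_h: "b i \<noteq> h i j" if "i < n" "j < n" "i \<noteq> j" for i j
      using lt'[of i j] lt'[of i "pd i"] that pd mod_add_cancel[of i n "pd i" j]
      by (auto simp: b_def h_def pre)
    have "half_edge_coloring G {..<n + 2} (\<lambda>i. (i + i) mod n) h"
    proof (rule half_edge_coloringI_missing[where a = "\<lambda>i. n + 1" and b = b], goal_cases)
      case (4 i) show ?case using lt' by simp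
    next
      case (5 i j)
      then show ?case using lt' mod_add_cancel[of i n j i] by (auto simp: V h_def)
    next
      case (6 i j l)
      then show ?case
        using lt' mod_add_cancel[of i n j l] pre_unique[of i j l] by (auto simp: V h_def split: if_splits)
    next
      case (7 i)
      then show ?case using lt'[of i i] b_lt[of i] b_v[of i] by (simp add: V)
    next
      case (8 i j)
      then show ?case using lt'[of i j] b_h[of i j] by (auto simp: V h_def)
    next
      case (9 i j)
      then show ?case
        using E'[of i j] pre_asym[of i j] lt'[of i j] lt'[of j i] by (auto simp: V h_def)
    next
      case (10 i j)
      then have i: "i < n" "j < n" "i \<noteq> j" by (simp_all add: V)
      then show ?case
        using 10(4) E'[of i j] mod_double_cancel[OF False i(1,2)] b_inj[OF i] b_lt[of i] b_lt[of j]
        by (auto simp: h_def add.commute doubleton_eq_iff)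
    qed (simp_all add: V)
    then show ?thesis by blast
  next
    case True
    define p where "p = n + 1"
    have p: "odd p" "n < p" using True by (auto simp: p_def)
    \<comment> \<open>For even \<open>n\<close> the modulus is \<open>n + 1\<close>, and for
      \<open>i > 0\<close> the residue not seen at \<open>i\<close> is \<open>i - 1\<close>; it
      becomes the replacement colour. At vertex 0 of a cycle the replacement is \<open>n + 1\<close>
      instead of the unseen residue \<open>n\<close>: with \<open>n\<close>, vertex 0 would miss
      \<open>n - 1\<close> and \<open>n + 1\<close>, just like vertex
      \<open>n div 2\<close>.\<close>
    define h where "h i j = (if pre i j then (if i = 0 then n + 1 else j) else (i + j) mod p)" for i j
    define a where "a i = (if i = 0 then n else n + 1)" for i :: nat
    define b where "b i = (if i = 0 then if cyc then n - 1 else n + 1 else (i + pd i) mod p)" for i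
    have lt: "(i + j) mod p \<le> n" for i j using n mod_less_divisor[of p "i + j"] unfolding p_def by linarith
    then have lt': "(i + j) mod p < n + 2" "(i + j) mod p \<noteq> n + 1" "n + 1 \<noteq> (i + j) mod p" for i j
      using lt[of i j] by linarith+
    have b_lt: "b i < n + 2" for i
      using lt' n by (auto simp: b_def)
    have pred: "(i + j) mod p \<noteq> i - 1" if "i < n" "j < n" "i \<noteq> 0" for i j
      using that mod_add_cases[of i p j] by (auto simp: p_def)
    have val: "(i + pd i) mod p = (if 2 * i \<le> p then 2 * i - 1 else 2 * i - 1 - p)"
      if "i < n" "i \<noteq> 0" for i
      using that p mod_add_cases[of i p "i - 1"] by (cases i) (auto simp: pd_def)
    have val_inj: "(i + pd i) mod p \<noteq> (j + pd j) mod p"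
      if "i < n" "j < n" "i \<noteq> j" "i \<noteq> 0" "j \<noteq> 0" for i j
      using that p(1) unfolding val[OF that(1,4)] val[OF that(2,5)]
      by (elim oddE) (auto split: if_splits; presburger)
    \<comment> \<open>The first vertex of a path misses \<open>n\<close> and \<open>n + 1\<close>,
      so no other vertex may free the residue \<open>n\<close>.\<close>
    have val_n: "(i + pd i) mod p \<noteq> n" if "i < n" "i \<noteq> 0" for i
      using that True unfolding val[OF that] by (auto simp: p_def split: if_splits; presburger)
    have ab: "{a i, b i} \<noteq> {a j, b j}" if "i < n" "j < n" "i \<noteq> j" for i j
      using that val_inj[of i j] val_n[of i] val_n[of j] lt'[of i "pd i"] lt'[of j "pd j"] n
      by (cases "i = 0"; cases "j = 0") (auto simp: a_def b_def doubleton_eq_iff simp del: One_nat_def)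
    have v: "a i \<noteq> b i \<and> a i \<noteq> (i + i) mod p \<and> b i \<noteq> (i + i) mod p" if "i < n" for i
      using that n p lt'[of i i] lt'[of i "pd i"] mod_add_cancel[of i p "pd i" i] pd[of i]
      by (cases "i = 0") (auto simp: a_def b_def simp del: One_nat_def)
    have ah: "a i \<noteq> h i j \<and> b i \<noteq> h i j \<and> h i j < n + 2 \<and> h i j \<noteq> (i + i) mod p"
      if ij: "i < n" "j < n" "i \<noteq> j" for i j
    proof (cases "i = 0")
      case True
      then show ?thesis using ij p n by (auto simp: a_def b_def h_def pre_def)
    next
      case False
      show ?thesis
      proof (cases "pre i j")
        case True
        then have "j = i - 1" "pd i = i - 1" using False by (simp_all add: pre_def pd_def)
        then show ?thesis
          using True False ij pred[of i i] pred[of i "pd i"] pd[of i] by (auto simp: a_def b_def h_def)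
      next
        case np: False
        have "j \<noteq> pd i" using False np by (auto simp: pre)
        then show ?thesis
          using np False ij p lt'[of i j] mod_add_cancel[of i p j i] mod_add_cancel[of i p "pd i" j] pd[of i]
          by (simp add: a_def b_def h_def)
      qed
    qed
    have inj: "j = l" if "i < n" "j < n" "l < n" "i \<noteq> j" "i \<noteq> l" "h i j = h i l" for i j l
    proof (cases "i = 0")
      case True
      then show ?thesis using that p by (auto simp: h_def pre_def split: if_splits)
    next
      case False
      then have "h i k = (if i = Suc k then i - 1 else (i + k) mod p)" for k
        by (auto simp: h_def pre_def)
      then show ?thesis
        using that p pred[of i j] pred[of i l] False mod_add_cancel[of i p j l]
        by (auto split: if_splits)
    qed
    have edge: "h i j \<noteq> h j i" if ij: "i < n" "j < n" "i \<noteq> j" "pre i j" for i j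
    proof (cases "i = 0")
      case True
      then show ?thesis
        using ij pre_asym[of i j] n by (auto simp: h_def p_def pre_def)
    next
      case False
      then have "i = Suc j" "\<not> pre j i" using ij pre_asym[of i j] by (auto simp: pre_def)
      then show ?thesis
        using ij pred[of i j] by (simp add: h_def add.commute)
    qed
    have "half_edge_coloring G {..<n + 2} (\<lambda>i. (i + i) mod p) h"
    proof (rule half_edge_coloringI_missing[where a = a and b = b], goal_cases)
      case (4 i) show ?case using lt' by simp
    next
      case (5 i j)
      then show ?case using ah[of i j] by (simp add: V)
    next
      case (6 i j l)
      then show ?case using inj[of i j l] by (simp add: V)
    next
      case (7 i)
      then show ?case using b_lt[of i] v[of i] by (simp add: V a_def)
    next
      case (8 i j)
      then show ?case using ah[of i j] by (simp add: V)
    next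
      case (9 i j)
      then show ?case using E'[of i j] edge[of i j] edge[of j i] by (auto simp: V)
    next
      case (10 i j)
      then have i: "i < n" "j < n" "i \<noteq> j" by (simp_all add: V)
      then show ?case
        using 10(4) E'[of i j] mod_double_cancel[OF p(1), of i j] ab[OF i] p
        by (auto simp: h_def add.commute)
    qed (simp_all add: V)
    then show ?thesis by blast
  qed
qed

lemma half_edge_coloring_path:
  assumes "n \<ge> 3" shows "\<exists>v h. half_edge_coloring (path_graph n) {..<n + 2} v h"
proof (rule half_edge_coloring_path_or_cycle[OF assms, where cyc = False])
  show "{i, j} \<in> edges (path_graph n) \<longleftrightarrow>
      i = Suc j \<or> j = Suc i \<or> False \<and> (i = 0 \<and> j = n - 1 \<or> j = 0 \<and> i = n - 1)"
    if "i < n" "j < n" for i j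
    using that by (auto simp: path_graph_def doubleton_eq_iff)
qed (simp add: path_graph_def)

lemma half_edge_coloring_cycle:
  assumes "n \<ge> 3" shows "\<exists>v h. half_edge_coloring (cycle_graph n) {..<n + 2} v h"
proof (rule half_edge_coloring_path_or_cycle[OF assms, where cyc = True])
  have suc: "Suc i mod n = (if i = n - 1 then 0 else Suc i)" if "i < n" for i
    using that by (cases "Suc i = n") auto
  show "{i, j} \<in> edges (cycle_graph n) \<longleftrightarrow>
      i = Suc j \<or> j = Suc i \<or> True \<and> (i = 0 \<and> j = n - 1 \<or> j = 0 \<and> i = n - 1)"
    if ij: "i < n" "j < n" for i j
  proof -
    have "{i, j} \<in> edges (cycle_graph n) \<longleftrightarrow> j = Suc i mod n \<or> i = Suc j mod n"
      using ij by (auto simp: cycle_graph_def doubleton_eq_iff)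
    then show ?thesis
      using ij by (auto simp: suc)
  qed
qed (simp add: cycle_graph_def)

subsection \<open>Joins of two graphs of the same order\<close>

text \<open>A total colouring of \<open>K\<^sub>m\<close> is given by a symmetric \<open>s\<close>, where \<open>s i i\<close> is the
  colour of the vertex \<open>i\<close>; the colour \<open>q i\<close> is missing at \<open>i\<close>.\<close>
definition complete_coloring :: "nat \<Rightarrow> (nat \<Rightarrow> nat \<Rightarrow> nat) \<Rightarrow> (nat \<Rightarrow> nat) \<Rightarrow> bool" where
  "complete_coloring m s q \<longleftrightarrow>
    (\<forall>i<m. \<forall>j<m. s i j = s j i \<and> s i j \<le> m \<and> q i \<noteq> s i j \<and> (s i i = s j j \<longrightarrow> i = j)) \<and>
    (\<forall>i<m. \<forall>j<m. \<forall>l<m. s i j = s i l \<longrightarrow> j = l) \<and> (\<forall>i<m. q i \<le> m)"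

lemma complete_coloring_exists: "\<exists>s q. complete_coloring m s q"
proof -
  define k where "k = (if odd m then m else m + 1)"
  have k: "odd k" "m \<le> k" "k \<le> m + 1" by (auto simp: k_def)
  have lt: "(i + j) mod k < k" for i j using k(1) by (cases "k = 0") auto
  have le: "(i + j) mod k \<le> m" for i j using lt[of i j] k(3) by linarith
  define q where "q i = (if odd m then m else (i + m) mod k)" for i
  have "q i \<noteq> (i + j) mod k" if "i < m" "j < m" for i j
  proof (cases "odd m")
    case True
    then have "q i = k" by (simp add: q_def k_def)
    then show ?thesis using lt[of i j] by (metis less_irrefl)
  next
    case False
    then show ?thesis using that mod_add_cancel[of i k m j] by (simp add: q_def k_def)
  qed
  moreover have "q i \<le> m" for i using le by (simp add: q_def)
  ultimately have "complete_coloring m (\<lambda>i j. (i + j) mod k) q"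
    using k le by (auto simp: complete_coloring_def add.commute mod_double_cancel mod_add_cancel)
  then show ?thesis by blast
qed

text \<open>The edge of \<open>G\<close> between \<open>x\<close> and the vertex numbered \<open>j\<close> uses the twin colour at \<open>x\<close>: exactly
  one end of each edge of \<open>G\<close> is switched.\<close>
definition switched :: "'a sgraph \<Rightarrow> ('a \<Rightarrow> nat) \<Rightarrow> 'a \<Rightarrow> nat \<Rightarrow> bool" where
  "switched G e x j \<longleftrightarrow> (\<exists>x'\<in>verts G. e x' = j \<and> {x, x'} \<in> edges G) \<and> j < e x"

lemma switched_iff:
  assumes "inj_on e (verts G)" "x' \<in> verts G"
  shows "switched G e x (e x') \<longleftrightarrow> {x, x'} \<in> edges G \<and> e x' < e x"
  using assms by (auto simp: switched_def inj_on_eq_iff)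

text \<open>The colours come in \<open>m + 1\<close> pairs of twins \<open>(False, c)\<close>, \<open>(True, c)\<close>. Inside each of the two
  graphs only one colour of a pair is used at a vertex, and its twin serves for a joining edge.\<close>
lemma half_edge_coloring_join_same_order:
  fixes G :: "'a sgraph" and H :: "'b sgraph"
  assumes G: "simple_graph G" and H: "simple_graph H" and ord: "order G = order H" "order G > 0"
  shows "\<exists>v h. half_edge_coloring (join_graph G H) {..<order (join_graph G H) + 2} v h"
proof -
  define m where "m = order G"
  have fin: "finite (verts G)" "finite (verts H)" using G H by (auto simp: simple_graph_def)
  obtain a where a: "bij_betw a (verts G) {..<m}"
    using numbering[OF fin(1)] by (auto simp: m_def order_def)
  obtain b where b: "bij_betw b (verts H) {..<m}"
    using numbering[OF fin(2)] ord by (auto simp: m_def order_def)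
  have al: "a x < m" if "x \<in> verts G" for x using a that by (auto simp: bij_betw_def)
  have bl: "b y < m" if "y \<in> verts H" for y using b that by (auto simp: bij_betw_def)
  have ai: "inj_on a (verts G)" and bi: "inj_on b (verts H)" using a b by (auto simp: bij_betw_def)
  note ae = inj_on_eq_iff[OF ai] and be = inj_on_eq_iff[OF bi]
  obtain s q where sq: "complete_coloring m s q" using complete_coloring_exists by blast
  \<comment> \<open>A cyclic shift of the \<open>m + 1\<close> colours without fixed points.
    \<open>H\<close> uses the shifted colouring \<open>t\<close>, so that the two ends of a joining
    edge between differently numbered vertices get different second components.\<close>
  define shift where "shift c = (if c = m then 0 else c + 1)" for c
  have shift: "shift c \<noteq> c" "c \<le> m \<Longrightarrow> shift c \<le> m" "shift c = shift d \<longleftrightarrow> c = d" if "c \<le> m" "d \<le> m" for c d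
    using that ord(2) by (auto simp: shift_def m_def split: if_splits)
  define t r where "t i j = shift (s i j)" and "r i = shift (q i)" for i j
  have s: "s i j = s j i" "s i j \<le> m" "q i \<noteq> s i j" "q i \<le> m" "s i i = s j j \<longleftrightarrow> i = j"
    if "i < m" "j < m" for i j using sq that by (auto simp: complete_coloring_def)
  have s_inj: "s i j = s i l \<longleftrightarrow> j = l" if "i < m" "j < m" "l < m" for i j l
    using sq that by (auto simp: complete_coloring_def)
  have t: "t i j = t j i" "t i j \<le> m" "r i \<noteq> t i j" "r i \<le> m" "t i i = t j j \<longleftrightarrow> i = j"
    if "i < m" "j < m" for i j
    using s[OF that] s[OF that(1) that(1)] s[OF that(2) that(2)] shift by (auto simp: t_def r_def)
  have t_inj: "t i j = t i l \<longleftrightarrow> j = l" if "i < m" "j < m" "l < m" for i j l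
    using s_inj[OF that] s(2) that shift(3) by (auto simp: t_def)
  have st: "s i j \<noteq> t j i" if "i < m" "j < m" for i j
    using s(1,2)[OF that] shift(1)[of "s i j"] by (auto simp: t_def)
  define J where "J = join_graph G H"
  define v where "v = case_sum (\<lambda>x. (False, s (a x) (a x))) (\<lambda>y. (True, t (b y) (b y)))"
  \<comment> \<open>The half-edge to the vertex of the other side numbered \<open>j\<close> takes
    the twin of the colour reserved for number \<open>j\<close> on the own side. Equal numbers have
    no such twin to use and take the colours \<open>q\<close> and \<open>r\<close>, with different
    first components at the two ends.\<close>
  define h where "h = case_sum
    (\<lambda>x. case_sum (\<lambda>x'. (switched G a x (a x'), s (a x) (a x')))
      (\<lambda>y. if a x = b y then (True, q (a x)) else (\<not> switched G a x (b y), s (a x) (b y))))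
    (\<lambda>y. case_sum (\<lambda>x. if a x = b y then (False, r (b y)) else (switched H b y (a x), t (b y) (a x)))
      (\<lambda>y'. (\<not> switched H b y (b y'), t (b y) (b y'))))"
  \<comment> \<open>What remains missing is the twin of the vertex colour and the twin of the
    \<open>q\<close> or \<open>r\<close> colour. Their first components differ, so on one side the
    missing pairs are told apart by the vertex colours, which are distinct.\<close>
  define ma where "ma = case_sum (\<lambda>x. (True, s (a x) (a x))) (\<lambda>y. (False, t (b y) (b y)))"
  define mb where "mb = case_sum (\<lambda>x. (False, q (a x))) (\<lambda>y. (True, r (b y)))"
  have hs: "h (Inl x) (Inl x') = (switched G a x (a x'), s (a x) (a x'))"
    "h (Inl x) (Inr y) = (if a x = b y then (True, q (a x)) else (\<not> switched G a x (b y), s (a x) (b y)))"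
    "h (Inr y) (Inl x) = (if a x = b y then (False, r (b y)) else (switched H b y (a x), t (b y) (a x)))"
    "h (Inr y) (Inr y') = (\<not> switched H b y (b y'), t (b y) (b y'))" for x x' y y'
    by (simp_all add: h_def)
  have vs: "v (Inl x) = (False, s (a x) (a x))" "v (Inr y) = (True, t (b y) (b y))"
    "ma (Inl x) = (True, s (a x) (a x))" "ma (Inr y) = (False, t (b y) (b y))"
    "mb (Inl x) = (False, q (a x))" "mb (Inr y) = (True, r (b y))" for x y
    by (simp_all add: v_def ma_def mb_def)
  have card: "card (verts J) = 2 * m"
    using order_join[OF G H] ord by (simp add: J_def order_def m_def)
  have V: "u \<in> verts J \<longleftrightarrow> (\<exists>x\<in>verts G. u = Inl x) \<or> (\<exists>y\<in>verts H. u = Inr y)" for u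
    by (auto simp: J_def verts_join)
  note E = edges_join[of _ _ G H, folded J_def]
  have qr: "q i \<le> m" "r i \<le> m" if "i < m" for i using s(4)[OF that that] t(4)[OF that that] .
  have qs: "q i \<noteq> s i j" "s i j \<noteq> q i" if "i < m" "j < m" for i j using s(3)[OF that] by auto
  have rt: "r i \<noteq> t i j" "t i j \<noteq> r i" if "i < m" "j < m" for i j using t(3)[OF that] by auto
  have "half_edge_coloring J (UNIV \<times> {..m}) v h"
  proof (rule half_edge_coloringI_missing[where a = ma and b = mb], goal_cases)
    case 1 show ?case using fin by (simp add: J_def verts_join)
  next
    case 2 show ?case by simp
  next
    case 3 show ?case by (simp add: card card_cartesian_product)
  next
    case (4 u) then show ?case using s(2) t(2) al bl by (auto simp: V vs)
  next
    case (5 u w) then show ?case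
      using s(2) t(2) qr al bl qs rt s_inj t_inj by (auto simp: V vs hs ae be split: if_splits)
  next
    case (6 u w z)
    then consider x where "u = Inl x" "x \<in> verts G" | y where "u = Inr y" "y \<in> verts H"
      by (auto simp: V)
    then show ?case
    proof cases
      case 1
      have ix: "a x < m" using al 1 by simp
      show ?thesis
        using 6(2-6) ix unfolding V 1(1)
        by (elim disjE bexE)
          (auto simp: hs ae be al bl s_inj qs split: if_splits)
    next
      case 2
      have iy: "b y < m" using bl 2 by simp
      show ?thesis
        using 6(2-6) iy unfolding V 2(1)
        by (elim disjE bexE)
          (auto simp: hs ae be al bl t_inj rt split: if_splits, metis ae)
    qed
  next
    case (7 u) then show ?case
      using s(2) t(2) qr al bl qs rt by (auto simp: V vs)
  next
    case (8 u w) then show ?case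
      using al bl qs rt s_inj t_inj by (auto simp: V vs hs ae be split: if_splits)
  next
    case (9 u w)
    consider x x' where "u = Inl x" "w = Inl x'" "x \<in> verts G" "x' \<in> verts G"
      | x y where "u = Inl x" "w = Inr y" "x \<in> verts G" "y \<in> verts H"
      | x y where "u = Inr y" "w = Inl x" "x \<in> verts G" "y \<in> verts H"
      | y y' where "u = Inr y" "w = Inr y'" "y \<in> verts H" "y' \<in> verts H"
      using 9(1,2) by (auto simp: V)
    then show ?case
    proof cases
      case 1
      then have "a x \<noteq> a x'" "{x, x'} \<in> edges G" "{x', x} \<in> edges G"
        using 9(3,4) by (auto simp: ae E insert_commute)
      then show ?thesis using 1 by (auto simp: hs switched_iff[OF ai])
    next
      case 2
      then show ?thesis using st[of "a x" "b y"] al bl by (auto simp: hs)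
    next
      case 3
      then show ?thesis using st[of "a x" "b y"] al bl by (auto simp: hs)
    next
      case 4
      then have "b y \<noteq> b y'" "{y, y'} \<in> edges H" "{y', y} \<in> edges H"
        using 9(3,4) by (auto simp: be E insert_commute)
      then show ?thesis using 4 by (auto simp: hs switched_iff[OF bi])
    qed
  next
    case (10 u w)
    then consider x x' where "u = Inl x" "w = Inl x'" "x \<in> verts G" "x' \<in> verts G"
      | y y' where "u = Inr y" "w = Inr y'" "y \<in> verts H" "y' \<in> verts H"
      by (auto simp: V E)
    then show ?case
    proof cases
      case 1
      then have "{x, x'} \<notin> edges G" "{x', x} \<notin> edges G" "x \<noteq> x'"
        using 10(3,4) by (auto simp: E insert_commute)
      then show ?thesis
        using 1 al s(1)[of "a x" "a x'"] s(5)[of "a x" "a x'"]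
        by (auto simp: hs vs ae switched_iff[OF ai] doubleton_eq_iff)
    next
      case 2
      then have "{y, y'} \<notin> edges H" "{y', y} \<notin> edges H" "y \<noteq> y'"
        using 10(3,4) by (auto simp: E insert_commute)
      then show ?thesis
        using 2 bl t(1)[of "b y" "b y'"] t(5)[of "b y" "b y'"]
        by (auto simp: hs vs be switched_iff[OF bi] doubleton_eq_iff)
    qed
  qed
  \<comment> \<open>The \<open>m + 1\<close> pairs of twins are \<open>2 * m + 2\<close> colours,
    which is the order of the join plus 2.\<close>
  then have "\<exists>v h. half_edge_coloring J {..<2 * m + 2 :: nat} v h"
    by (rule half_edge_coloring_lessThan) (simp_all add: card_cartesian_product)
  moreover have "order J = 2 * m" using card by (simp add: order_def)
  ultimately show ?thesis unfolding J_def by simp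
qed

section \<open>The AVD-TCC for central graphs of joins and of complete bipartite graphs\<close>

theorem proposition5p4:
  "(\<forall>(G1 :: 'a sgraph) (G2 :: 'b sgraph).
      simple_graph G1 \<and> simple_graph G2 \<and> order G1 \<ge> 3 \<and> order G2 \<ge> 3 \<longrightarrow>
      satisfies_avd_tcc (central_graph G1) \<and> satisfies_avd_tcc (central_graph G2) \<longrightarrow>
      satisfies_avd_tcc (central_graph (join_graph G1 G2)))
   \<and> (\<forall>m n. m \<ge> 3 \<and> n \<ge> 3 \<longrightarrow>
      satisfies_avd_tcc (central_graph (complete_bipartite_graph m n)))
   \<and> (\<forall>m n. m \<ge> 3 \<and> n \<ge> 3 \<longrightarrow>
      (\<forall>G1 \<in> {path_graph n, cycle_graph n, complete_graph n}.
       \<forall>G2 \<in> {path_graph m, cycle_graph m, complete_graph m}.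
         satisfies_avd_tcc (central_graph (join_graph G1 G2))))
   \<and> (\<forall>(G1 :: 'a sgraph) (G2 :: 'b sgraph).
      simple_graph G1 \<and> simple_graph G2 \<and> order G1 \<ge> 3 \<and> order G2 \<ge> 3 \<longrightarrow>
      order G1 = order G2 \<longrightarrow>
      satisfies_avd_tcc (central_graph (join_graph G1 G2)))"
proof (intro conjI allI impI ballI)
  fix G1 :: "'a sgraph" and G2 :: "'b sgraph"
  assume G: "simple_graph G1 \<and> simple_graph G2 \<and> order G1 \<ge> 3 \<and> order G2 \<ge> 3"
    and "satisfies_avd_tcc (central_graph G1) \<and> satisfies_avd_tcc (central_graph G2)"
  then show "satisfies_avd_tcc (central_graph (join_graph G1 G2))"
    by (metis tcc_of_join half_edge_coloring_of_tcc)
next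
  fix m n :: nat
  assume mn: "m \<ge> 3 \<and> n \<ge> 3"
  let ?E = "\<lambda>n. \<lparr>verts = {..<n :: nat}, edges = {}\<rparr>"
  \<comment> \<open>A complete bipartite graph is the join of two edgeless graphs, whose half-edge
    colourings are available.\<close>
  have "complete_bipartite_graph m n = join_graph (?E m) (?E n)"
    by (auto simp: complete_bipartite_graph_def join_graph_def)
  moreover have "simple_graph (?E k)" "order (?E k) = k"
    "\<exists>v h. half_edge_coloring (?E k) {..<k + 2} v h" for k
    using half_edge_coloring_edgeless[of "?E k" k] by (simp_all add: simple_graph_def order_def)
  ultimately show "satisfies_avd_tcc (central_graph (complete_bipartite_graph m n))"
    using mn by (auto intro!: tcc_of_join)
next
  fix m n :: nat and G1 G2
  assume mn: "m \<ge> 3 \<and> n \<ge> 3"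
    and G: "G1 \<in> {path_graph n, cycle_graph n, complete_graph n}"
      "G2 \<in> {path_graph m, cycle_graph m, complete_graph m}"
  have "simple_graph F \<and> order F = k \<and> (\<exists>v h. half_edge_coloring F {..<k + 2} v h)"
    if "F \<in> {path_graph k, cycle_graph k, complete_graph k}" "k \<ge> 3" for F k
    using that simple_graph_path simple_graph_cycle simple_graph_complete half_edge_coloring_path
      half_edge_coloring_cycle half_edge_coloring_complete[of k]
    by (auto simp: order_def path_graph_def cycle_graph_def complete_graph_def)
  from this[OF G(1)] this[OF G(2)] mn show "satisfies_avd_tcc (central_graph (join_graph G1 G2))"
    by (intro tcc_of_join) auto
next
  fix G1 :: "'a sgraph" and G2 :: "'b sgraph"
  assume G: "simple_graph G1 \<and> simple_graph G2 \<and> order G1 \<ge> 3 \<and> order G2 \<ge> 3"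
    and ord: "order G1 = order G2"
  then obtain v h where
    h: "half_edge_coloring (join_graph G1 G2) {..<order (join_graph G1 G2) + 2} v h"
    using half_edge_coloring_join_same_order[of G1 G2] by auto
  show "satisfies_avd_tcc (central_graph (join_graph G1 G2))"
    by (rule tcc_of_half_edge_coloring[OF _ _ h])
      (use G in \<open>simp_all add: simple_graph_join order_join\<close>)
qed

end
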